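(* Let $0<q<1$. Then $\frac{d}{dx}[x]_q=\frac{d}{dx}[x]_q^*=0$ for almost every $x\in\mathbb R$ with respect to Lebesgue measure.
   Context: $[n]_q=\frac{1-q^n}{1-q}$. For real $x\ge1$ write uniquely $x=[[c_1,c_2,\ldots]]:=c_1-\frac{1}{c_2-\frac{1}{c_3-\cdots}}$ with integers $c_j\ge2$; for $0<q<1$ the number $[x]_q$ is the limit as $N\to\infty$ of the real numbers $[c_1]_q-\frac{q^{c_1-1}}{[c_2]_q-\cdots\frac{q^{c_{N-1}-1}}{[c_N]_q}}$ (the limit exists). It is extended to all real $x$ by $[x+1]_q=q[x]_q+1$. For fixed $0<q<1$ the function $x\mapsto[x]_q$ is strictly increasing on $\mathbb R$, continuous at irrational points and right-continuous at rational points. For $y\in\mathbb Q$ put $\mathrm{Jump}_y(q):=[y]_q-\lim_{u\to y^-}[u]_q>0$, and $$[x]_q^*:=[x]_q+\sum_{y\in\mathbb Q,\ y>x}\mathrm{Jump}_y(q),$$ which is a continuous non-decreasing function of $x$. *)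

theory Defs
  imports "HOL-Analysis.Analysis"
begin

definition qint :: "real \<Rightarrow> nat \<Rightarrow> real" where
  "qint q n = (1 - q ^ n) / (1 - q)"

text \<open>
  Coefficient sequences are indexed from 0: \<open>ncf c N\<close> is the convergent
  \<open>c 0 - 1 / (c 1 - \<dots> - 1 / c N)\<close> with \<open>N + 1\<close> coefficients, and similarly for \<open>qncf\<close>.
\<close>

primrec ncf :: "(nat \<Rightarrow> nat) \<Rightarrow> nat \<Rightarrow> real" where
  "ncf c 0 = real (c 0)"
| "ncf c (Suc N) = real (c 0) - 1 / ncf (\<lambda>j. c (Suc j)) N"

primrec qncf :: "real \<Rightarrow> (nat \<Rightarrow> nat) \<Rightarrow> nat \<Rightarrow> real" where
  "qncf q c 0 = qint q (c 0)"
| "qncf q c (Suc N) = qint q (c 0) - q ^ (c 0 - 1) / qncf q (\<lambda>j. c (Suc j)) N"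

text \<open>
  Every \<open>x \<ge> 1\<close> has exactly one infinite expansion with all coefficients at least 2;
  expansions of rational numbers end in \<open>2, 2, 2, \<dots>\<close>, e.g. \<open>1 = [[2, 2, 2, \<dots>]]\<close>.
\<close>

definition ncf_expansion :: "real \<Rightarrow> nat \<Rightarrow> nat" where
  "ncf_expansion x = (THE c. (\<forall>j. 2 \<le> c j) \<and> ncf c \<longlonglongrightarrow> x)"

text \<open>
  Below 1 the recursion solves \<open>[x + 1]\<^sub>q = q [x]\<^sub>q + 1\<close> for \<open>[x]\<^sub>q\<close>.
\<close>

function qreal :: "real \<Rightarrow> real \<Rightarrow> real" where
  "qreal q x = (if 1 \<le> x then lim (qncf q (ncf_expansion x)) else (qreal q (x + 1) - 1) / q)"
  by auto
termination
  by (relation "Wellfounded.measure (\<lambda>(q, x). nat \<lceil>1 - x\<rceil>)") (auto, linarith)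

declare qreal.simps [simp del]

definition qjump :: "real \<Rightarrow> real \<Rightarrow> real" where
  "qjump q y = qreal q y - Lim (at_left y) (qreal q)"

definition qreal_star :: "real \<Rightarrow> real \<Rightarrow> real" where
  "qreal_star q x = qreal q x + (\<Sum>\<^sub>\<infinity>y\<in>{y \<in> \<rat>. x < y}. qjump q y)"

end

theory Submission
  imports Defs
begin

text \<open>
  Write \<open>f\<close> for the map \<open>x \<mapsto> [x]\<^sub>q\<close>. The increments of its continuous companion are nonnegative and at most
  those of \<open>f\<close>, because the jumps in \<open>(a, b]\<close> add up to at most \<open>f b - f a\<close>. Both functions therefore
  have derivative \<open>0\<close> wherever the symmetric increment \<open>f (x + h) - f (x - h)\<close> is \<open>o(h)\<close>, and it remains
  to see that, for each \<open>t > 0\<close>, the set of those \<open>x\<close> for which this increment exceeds \<open>t * h\<close> for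
  arbitrarily small \<open>h\<close> is a null set.

  Inside an open set over which \<open>f\<close> increases by at most \<open>V\<close>, this set has outer measure
  at most \<open>10 * V / t\<close>, by the Vitali covering lemma (\<open>steep_points_outer_le\<close>). This bound is combined with the
  fact that \<open>f\<close> grows only by jumping at rational points. Cut the half-line \<open>t > 1\<close> at the integers; the piece
  \<open>(c - 1, c)\<close> consists of the numbers \<open>c - 1 / t'\<close> with \<open>t' > 1\<close>, so the cutting can be
  repeated. On \<open>(c - 1, c)\<close> the function \<open>f\<close> increases from \<open>[c - 1]\<^sub>q\<close> only towards \<open>[c - 1]\<^sub>q + q\<^sup>c\<close>, whereas
  \<open>[c]\<^sub>q - [c - 1]\<^sub>q = q\<^bsup>c - 1\<^esup>\<close>, so a fixed fraction of the growth of \<open>f\<close> is spent in the jumps at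
  the cuts. On a cylinder, where \<open>f\<close> is transported by a fractional linear map, this fraction is
  distorted, but the distortion is bounded because the pole of the map never exceeds \<open>q < 1\<close>. Every
  subdivision thus multiplies the total growth inside the cylinders by at most \<open>1 - (1 - q)\<^sup>2\<close> (\<open>q_mass_child_le\<close>).
  After \<open>n\<close> subdivisions, which omit only countably many points, the outer measure is bounded by a multiple of
  \<open>(1 - (1 - q)\<^sup>2) ^ n\<close> (\<open>steep_points_in_q_cylinder\<close>), for every \<open>n\<close>.
\<close>

section \<open>Steep points of a monotone function\<close>

text \<open>
  A bound for the outer Lebesgue measure of \<open>S\<close>, expressed through a Borel cover: \<open>emeasure\<close> is \<open>0\<close> by default on
  sets that are not measurable, so a bound for its value at \<open>S\<close> would by itself say nothing.
\<close>

definition outer_le :: "real set \<Rightarrow> real \<Rightarrow> bool" where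
  "outer_le S V \<longleftrightarrow> (\<exists>A\<in>sets lborel. S \<subseteq> A \<and> emeasure lborel A \<le> ennreal V)"

lemma outer_le_mono: "outer_le T V \<Longrightarrow> S \<subseteq> T \<Longrightarrow> V \<le> W \<Longrightarrow> outer_le S W"
  unfolding outer_le_def by (meson ennreal_leI order_trans)

lemma outer_le_Un_countable:
  assumes "outer_le S V" "countable N"
  shows "outer_le (S \<union> N) V"
proof -
  obtain A where A: "A \<in> sets lborel" "S \<subseteq> A" "emeasure lborel A \<le> ennreal V"
    using assms(1) unfolding outer_le_def by blast
  have N: "N \<in> sets lborel" "emeasure lborel N = 0"
    using assms(2) by (auto intro: sets.countable simp: emeasure_lborel_countable)
  have "emeasure lborel (A \<union> N) \<le> emeasure lborel A + emeasure lborel N"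
    using A N by (intro emeasure_subadditive)
  with A N show ?thesis unfolding outer_le_def by (intro bexI[of _ "A \<union> N"]) auto
qed

lemma outer_le_UN_countable:
  assumes "countable I"
    and outer: "\<And>i. i \<in> I \<Longrightarrow> outer_le (S i) (v i)"
    and nonneg: "\<And>i. i \<in> I \<Longrightarrow> 0 \<le> v i"
    and sums: "\<And>F. finite F \<Longrightarrow> F \<subseteq> I \<Longrightarrow> sum v F \<le> V"
  shows "outer_le (\<Union>i\<in>I. S i) V"
proof -
  have "\<forall>i\<in>I. \<exists>A\<in>sets lborel. S i \<subseteq> A \<and> emeasure lborel A \<le> ennreal (v i)"
    using outer unfolding outer_le_def by blast
  then obtain A where A: "\<And>i. i \<in> I \<Longrightarrow> A i \<in> sets lborel" "\<And>i. i \<in> I \<Longrightarrow> S i \<subseteq> A i"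
    "\<And>i. i \<in> I \<Longrightarrow> emeasure lborel (A i) \<le> ennreal (v i)"
    by metis
  define J where "J = to_nat_on I ` I"
  define B where "B n = (if n \<in> J then A (from_nat_into I n) else {})" for n
  have from_J: "from_nat_into I n \<in> I" if "n \<in> J" for n
    using that assms(1) unfolding J_def by auto
  have inj: "inj_on (from_nat_into I) J"
    using assms(1) unfolding J_def by (auto simp: inj_on_def)
  have B: "range B \<subseteq> sets lborel" unfolding B_def using A(1) from_J by auto
  have "S i \<subseteq> (\<Union>n. B n)" if "i \<in> I" for i
  proof -
    have "B (to_nat_on I i) = A i" unfolding B_def J_def using that assms(1) by auto
    with A(2)[OF that] show ?thesis by blast
  qed
  hence "(\<Union>i\<in>I. S i) \<subseteq> (\<Union>n. B n)" by blast
  moreover have "(\<Sum>n<N. emeasure lborel (B n)) \<le> ennreal V" for N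
  proof -
    have "(\<Sum>n<N. emeasure lborel (B n)) = (\<Sum>n\<in>{..<N} \<inter> J. emeasure lborel (B n))"
      by (rule sum.mono_neutral_right) (auto simp: B_def)
    also have "\<dots> \<le> (\<Sum>n\<in>{..<N} \<inter> J. ennreal (v (from_nat_into I n)))"
      by (intro sum_mono) (auto simp: B_def A(3) from_J)
    also have "\<dots> = ennreal (\<Sum>n\<in>{..<N} \<inter> J. v (from_nat_into I n))"
      by (intro sum_ennreal) (auto simp: nonneg from_J)
    also have "(\<Sum>n\<in>{..<N} \<inter> J. v (from_nat_into I n)) = sum v (from_nat_into I ` ({..<N} \<inter> J))"
      by (subst sum.reindex) (auto intro: inj_on_subset[OF inj])
    also have "ennreal \<dots> \<le> ennreal V"
      by (intro ennreal_leI sums) (auto simp: from_J)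
    finally show ?thesis .
  qed
  hence "(\<Sum>n. emeasure lborel (B n)) \<le> ennreal V"
    by (intro suminf_le_const summableI)
  hence "emeasure lborel (\<Union>n. B n) \<le> ennreal V"
    using emeasure_subadditive_countably[OF B] by (rule order_trans[rotated])
  ultimately show ?thesis
    unfolding outer_le_def using B by (intro bexI[of _ "\<Union>n. B n"]) auto
qed

lemma AE_not_in_of_outer_le:
  assumes outer: "\<And>n. outer_le S (v n)" and "v \<longlonglongrightarrow> 0"
  shows "AE x in lborel. x \<notin> S"
proof -
  obtain A where A: "\<And>n. A n \<in> sets lborel" "\<And>n. S \<subseteq> A n"
    "\<And>n. emeasure lborel (A n) \<le> ennreal (v n)"
    using outer unfolding outer_le_def by metis
  have meas: "(\<Inter>n. A n) \<in> sets lborel" using A(1) by (intro sets.countable_INT') auto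
  have "emeasure lborel (\<Inter>n. A n) \<le> ennreal (v n)" for n
    using A(1) by (intro order_trans[OF emeasure_mono A(3)[of n]]) auto
  moreover have "(\<lambda>n. ennreal (v n)) \<longlonglongrightarrow> 0"
    using tendsto_ennrealI[OF assms(2)] by simp
  ultimately have "emeasure lborel (\<Inter>n. A n) \<le> 0"
    by (intro LIMSEQ_le_const) auto
  thus ?thesis using meas A(2) by (intro AE_I'[of "\<Inter>n. A n"]) auto
qed

text \<open>
  Symmetric increments are used because they are increments over closed balls, the sets to which
  the Vitali covering lemma applies.
\<close>

definition steep_points :: "(real \<Rightarrow> real) \<Rightarrow> real \<Rightarrow> real set" where
  "steep_points f t = {x. \<forall>\<delta>>0. \<exists>h. 0 < h \<and> h < \<delta> \<and> t * h < f (x + h) - f (x - h)}"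

lemma sum_increments_le:
  fixes f :: "real \<Rightarrow> real"
  assumes "mono f" "finite F"
    and "\<And>i. i \<in> F \<Longrightarrow> a \<le> l i \<and> l i \<le> u i \<and> u i \<le> b" "a \<le> b"
    and "\<And>i j. i \<in> F \<Longrightarrow> j \<in> F \<Longrightarrow> i \<noteq> j \<Longrightarrow> {l i..u i} \<inter> {l j..u j} = {}"
  shows "(\<Sum>i\<in>F. f (u i) - f (l i)) \<le> f b - f a"
  using assms(2-)
proof (induction F arbitrary: b rule: finite_ranking_induct[where f = u])
  case empty
  thus ?case using monoD[OF assms(1), of a b] by simp
next
  case (insert i F)
  show ?case
  proof (cases "i \<in> F")
    case True
    thus ?thesis using insert by (simp add: insert_absorb)
  next
    case False
    have "u j \<le> l i" if "j \<in> F" for j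
    proof (rule ccontr)
      assume "\<not> u j \<le> l i"
      hence "u j \<in> {l i..u i} \<inter> {l j..u j}" using that insert.hyps insert.prems(1)[of j] by auto
      thus False using insert.prems(3)[of i j] that False by auto
    qed
    hence "(\<Sum>j\<in>F. f (u j) - f (l j)) \<le> f (l i) - f a"
      using insert.prems by (intro insert.IH) auto
    moreover have "f (u i) \<le> f b" using insert.prems(1)[of i] by (intro monoD[OF assms(1)]) auto
    ultimately show ?thesis using insert.hyps False by simp
  qed
qed

text \<open>
  The weak-type maximal inequality. Each steep point is the centre of a ball inside \<open>S\<close> whose radius is at most
  \<open>1 / t\<close> times the increment of \<open>f\<close> over it. The Vitali lemma selects disjoint balls, whose increments
  add up to at most \<open>V\<close> and whose fivefold enlargements, of length \<open>10 * r\<close> each, still cover.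
\<close>

lemma steep_points_outer_le:
  fixes f :: "real \<Rightarrow> real"
  assumes f: "mono f" and "open S" "0 < t" "0 \<le> V"
    and V: "\<And>u v. u \<in> S \<Longrightarrow> v \<in> S \<Longrightarrow> f v - f u \<le> V"
  shows "outer_le (steep_points f t \<inter> S) (10 / t * V)"
proof -
  define E where "E = steep_points f t \<inter> S"
  have "\<exists>r. 0 < r \<and> r \<le> 1 \<and> cball x r \<subseteq> S \<and> t * r \<le> f (x + r) - f (x - r)"
    if "x \<in> E" for x
  proof -
    have x: "x \<in> steep_points f t" "x \<in> S" using that unfolding E_def by simp_all
    obtain e where e: "0 < e" "cball x e \<subseteq> S"
      using open_contains_cball[THEN iffD1, rule_format, OF \<open>open S\<close> x(2)] by auto
    have "0 < min e 1" using e(1) by simp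
    then obtain r where r: "0 < r" "r < min e 1" "t * r < f (x + r) - f (x - r)"
      using x(1) unfolding steep_points_def mem_Collect_eq by blast
    have "cball x r \<subseteq> cball x e" using r by (intro subset_cball) simp
    with r e show ?thesis by (intro exI[of _ r]) auto
  qed
  then obtain r where r: "\<And>x. x \<in> E \<Longrightarrow> 0 < r x \<and> r x \<le> 1"
    "\<And>x. x \<in> E \<Longrightarrow> cball x (r x) \<subseteq> S"
    "\<And>x. x \<in> E \<Longrightarrow> t * r x \<le> f (x + r x) - f (x - r x)"
    by metis
  have "E \<subseteq> (\<Union>x\<in>E. cball x (r x))" using r(1) by (force simp: less_imp_le)
  then obtain C where C: "countable C" "C \<subseteq> E"
    "pairwise (\<lambda>x y. disjnt (cball x (r x)) (cball y (r y))) C"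
    "E \<subseteq> (\<Union>x\<in>C. cball x (5 * r x))"
    using r(1) by (rule Vitali_covering_lemma_cballs)
  have "outer_le (\<Union>x\<in>C. cball x (5 * r x)) (10 / t * V)"
  proof (rule outer_le_UN_countable[OF C(1), where v = "\<lambda>x. 10 * r x"])
    fix x assume "x \<in> C"
    hence rx: "0 < r x" using C(2) r(1) by blast
    thus "0 \<le> 10 * r x" by simp
    have "cball x (5 * r x) = {x - 5 * r x..x + 5 * r x}" by (rule cball_eq_atLeastAtMost)
    thus "outer_le (cball x (5 * r x)) (10 * r x)"
      unfolding outer_le_def using rx by (intro bexI[of _ "cball x (5 * r x)"]) auto
  next
    fix F assume F: "finite F" "F \<subseteq> C"
    show "(\<Sum>x\<in>F. 10 * r x) \<le> 10 / t * V"
    proof (cases "F = {}")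
      case True
      thus ?thesis using assms by simp
    next
      case False
      define a where "a = Min ((\<lambda>x. x - r x) ` F)"
      define b where "b = Max ((\<lambda>x. x + r x) ` F)"
      have E: "x \<in> E" if "x \<in> F" for x using that F C by blast
      have ends: "x - r x \<in> S" "x + r x \<in> S" if "x \<in> F" for x
        using r(1,2)[OF E[OF that]] by (auto simp: subset_iff dist_real_def)
      have "a \<in> (\<lambda>x. x - r x) ` F" unfolding a_def using F False by (intro Min_in) auto
      hence aS: "a \<in> S" using ends by auto
      have "b \<in> (\<lambda>x. x + r x) ` F" unfolding b_def using F False by (intro Max_in) auto
      hence bS: "b \<in> S" using ends by auto
      have ab: "a \<le> x - r x \<and> x - r x \<le> x + r x \<and> x + r x \<le> b" if "x \<in> F" for x
        unfolding a_def b_def using that F r(1)[OF E[OF that]] by auto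
      have "(\<Sum>x\<in>F. t * r x) \<le> (\<Sum>x\<in>F. f (x + r x) - f (x - r x))"
        using r(3) E by (intro sum_mono) auto
      also have "\<dots> \<le> f b - f a"
      proof (rule sum_increments_le[OF f F(1) ab])
        show "a \<le> b" using ab False by force
        show "{x - r x..x + r x} \<inter> {y - r y..y + r y} = {}" if "x \<in> F" "y \<in> F" "x \<noteq> y" for x y
          using C(3) that F(2) unfolding pairwise_def disjnt_def cball_eq_atLeastAtMost by blast
      qed auto
      also have "\<dots> \<le> V" using V aS bS by blast
      finally have "t * sum r F \<le> V" by (simp add: sum_distrib_left)
      hence "sum r F \<le> V / t" using \<open>0 < t\<close> by (simp add: field_simps)
      thus ?thesis unfolding sum_distrib_left[symmetric] by simp
    qed
  qed
  thus ?thesis using C(4) unfolding E_def by (rule outer_le_mono) simp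
qed

lemma has_derivative_0_of_not_steep:
  fixes f g :: "real \<Rightarrow> real"
  assumes f: "mono f" and g: "mono g"
    and dom: "\<And>u v. u \<le> v \<Longrightarrow> g v - g u \<le> f v - f u"
    and flat: "\<And>k::nat. x \<notin> steep_points f (1 / Suc k)"
  shows "(g has_real_derivative 0) (at x)"
  unfolding DERIV_def
proof (rule LIM_I)
  fix e :: real assume "0 < e"
  then obtain k where k: "1 / Suc k < e" using nat_approx_posE by blast
  obtain \<delta> where \<delta>: "0 < \<delta>" "\<And>h. 0 < h \<Longrightarrow> h < \<delta> \<Longrightarrow> f (x + h) - f (x - h) \<le> 1 / Suc k * h"
    using flat[of k] unfolding steep_points_def mem_Collect_eq by (meson not_less)
  have "norm ((g (x + h) - g x) / h - 0) < e" if h: "h \<noteq> 0" "norm (h - 0) < \<delta>" for h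
  proof -
    have inc: "g (x - \<bar>h\<bar>) \<le> g x" "g x \<le> g (x + \<bar>h\<bar>)" by (intro monoD[OF g]; simp)+
    have "\<bar>g (x + h) - g x\<bar> \<le> g (x + \<bar>h\<bar>) - g (x - \<bar>h\<bar>)"
      using inc by (cases "0 \<le> h") auto
    also have "\<dots> \<le> f (x + \<bar>h\<bar>) - f (x - \<bar>h\<bar>)" by (rule dom) simp
    also have "\<dots> \<le> 1 / Suc k * \<bar>h\<bar>" using h by (intro \<delta>(2)) auto
    also have "\<dots> < e * \<bar>h\<bar>" using k h by (intro mult_strict_right_mono) auto
    finally show ?thesis using h by (simp add: abs_divide divide_less_eq)
  qed
  thus "\<exists>s>0. \<forall>h. h \<noteq> 0 \<and> norm (h - 0) < s \<longrightarrow> norm ((g (x + h) - g x) / h - 0) < e"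
    using \<delta>(1) by blast
qed

section \<open>Left jumps of a monotone function\<close>

definition left_jump :: "(real \<Rightarrow> real) \<Rightarrow> real \<Rightarrow> real" where
  "left_jump f y = f y - Lim (at_left y) f"

lemma left_limit_bounds:
  fixes f :: "real \<Rightarrow> real"
  assumes f: "mono f"
  shows "Lim (at_left y) f \<le> f y" and "u < y \<Longrightarrow> f u \<le> Lim (at_left y) f"
proof -
  have "(f \<longlongrightarrow> Sup (f ` ({..<y} \<inter> UNIV))) (at y within ({..<y} \<inter> UNIV))"
    by (rule Lim_left_bound[where K = "f y"]) (auto intro: monoD[OF f])
  hence "(f \<longlongrightarrow> Sup (f ` {..<y})) (at_left y)" by simp
  hence eq: "Lim (at_left y) f = Sup (f ` {..<y})" by (intro tendsto_Lim) auto
  show "Lim (at_left y) f \<le> f y"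
    unfolding eq by (rule cSup_least) (auto intro: monoD[OF f])
  show "f u \<le> Lim (at_left y) f" if "u < y"
    unfolding eq using that by (intro cSup_upper bdd_aboveI[of _ "f y"]) (auto intro: monoD[OF f])
qed

lemma left_jump_nonneg: "mono f \<Longrightarrow> 0 \<le> left_jump f y"
  using left_limit_bounds(1) by (simp add: left_jump_def)

text \<open>
  Between two consecutive points of \<open>F\<close> the function does not decrease, so the growth over \<open>(a, b]\<close> pays for
  every jump separately.
\<close>

lemma sum_left_jumps_le:
  fixes f :: "real \<Rightarrow> real"
  assumes f: "mono f" and "finite F"
  shows "F \<subseteq> {a<..b} \<Longrightarrow> a \<le> b \<Longrightarrow> sum (left_jump f) F \<le> f b - f a"
  using assms(2)
proof (induction F arbitrary: b rule: finite_linorder_max_induct)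
  case empty
  thus ?case using monoD[OF f, of a b] by simp
next
  case (insert y F)
  define z where "z = Max (insert a F)"
  have fin: "finite (insert a F)" using insert.hyps by simp
  have "z < y" unfolding z_def using insert fin by (subst Max_less_iff) auto
  have "F \<subseteq> {a<..z}" "a \<le> z" using insert.prems fin unfolding z_def by (auto intro: Max_ge)
  hence "sum (left_jump f) F \<le> f z - f a" by (rule insert.IH)
  moreover have "f z \<le> Lim (at_left y) f" using \<open>z < y\<close> by (rule left_limit_bounds[OF f])
  moreover have "f y \<le> f b" using insert.prems by (intro monoD[OF f]) auto
  moreover have "y \<notin> F" using insert.hyps by blast
  ultimately show ?case using insert.hyps by (simp add: left_jump_def)
qed

text \<open>
  Passing from \<open>a\<close> to \<open>b\<close> loses exactly the jumps in \<open>(a, b]\<close>, whose total lies between \<open>0\<close> and \<open>f b - f a\<close>. The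
  upper bound on \<open>f\<close> makes the series of later jumps converge.
\<close>

lemma
  fixes f :: "real \<Rightarrow> real" and Y :: "real set"
  assumes f: "mono f" and bound: "\<And>x. f x \<le> K"
  defines "g \<equiv> \<lambda>x. f x + (\<Sum>\<^sub>\<infinity>y\<in>{y \<in> Y. x < y}. left_jump f y)"
  shows mono_add_later_jumps: "mono g"
    and add_later_jumps_increment_le: "a \<le> b \<Longrightarrow> g b - g a \<le> f b - f a"
proof -
  have summable: "left_jump f summable_on A" if "A \<subseteq> {x<..}" for A x
  proof (rule nonneg_bdd_above_summable_on)
    show "bdd_above (sum (left_jump f) ` {F. F \<subseteq> A \<and> finite F})"
    proof (rule bdd_aboveI[of _ "K - f x"], clarsimp)
      fix F assume F: "F \<subseteq> A" "finite F"
      define b where "b = Max (insert x F)"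
      have "x \<le> b" "F \<subseteq> {x<..b}" using F that unfolding b_def by (auto intro: Max_ge)
      hence "sum (left_jump f) F \<le> f b - f x" using F by (intro sum_left_jumps_le[OF f])
      thus "sum (left_jump f) F \<le> K - f x" using bound[of b] by linarith
    qed
  qed (use left_jump_nonneg[OF f] in auto)
  have increment: "g b - g a = f b - f a - infsum (left_jump f) {y \<in> Y. a < y \<and> y \<le> b}"
    if "a \<le> b" for a b
  proof -
    have "{y \<in> Y. a < y} = {y \<in> Y. a < y \<and> y \<le> b} \<union> {y \<in> Y. b < y}" using that by auto
    moreover have "infsum (left_jump f) ({y \<in> Y. a < y \<and> y \<le> b} \<union> {y \<in> Y. b < y})
        = infsum (left_jump f) {y \<in> Y. a < y \<and> y \<le> b} + infsum (left_jump f) {y \<in> Y. b < y}"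
      by (intro infsum_Un_disjoint summable[of _ a] summable[of _ b]) auto
    ultimately show ?thesis unfolding g_def by simp
  qed
  have "infsum (left_jump f) {y \<in> Y. a < y \<and> y \<le> b} \<le> f b - f a" if "a \<le> b" for a b
    using that by (intro infsum_le_finite_sums summable[of _ a] sum_left_jumps_le[OF f]) auto
  hence "g a \<le> g b" if "a \<le> b" for a b using that increment[OF that] by fastforce
  thus "mono g" by (rule monoI)
  have "0 \<le> infsum (left_jump f) {y \<in> Y. a < y \<and> y \<le> b}"
    using left_jump_nonneg[OF f] by (intro infsum_nonneg)
  thus "g b - g a \<le> f b - f a" if "a \<le> b" using increment[OF that] by linarith
qed

section \<open>Negative continued fraction expansions\<close>

text \<open>
  The expansion is computed greedily: \<open>1 / y \<in> (0, 1]\<close> for a remainder \<open>y \<ge> 1\<close>, so \<open>x = c - 1 / y\<close> forces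
  \<open>c - 1 \<le> x < c\<close>, and an integer \<open>x\<close> has leading digit \<open>x + 1\<close>.
\<close>

definition leading_digit :: "real \<Rightarrow> nat" where
  "leading_digit x = nat (\<lfloor>x\<rfloor> + 1)"

definition tail :: "real \<Rightarrow> real" where
  "tail x = 1 / (of_int \<lfloor>x\<rfloor> + 1 - x)"

primrec digits :: "real \<Rightarrow> nat \<Rightarrow> nat" where
  "digits x 0 = leading_digit x"
| "digits x (Suc j) = digits (tail x) j"

lemma real_leading_digit: "1 \<le> x \<Longrightarrow> real (leading_digit x) = of_int \<lfloor>x\<rfloor> + 1"
  unfolding leading_digit_def by (simp add: le_floor_iff)

lemma leading_digit_ge_2: "1 \<le> x \<Longrightarrow> 2 \<le> leading_digit x"
proof -
  assume "1 \<le> x"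
  hence "1 \<le> \<lfloor>x\<rfloor>" by (simp add: le_floor_iff)
  thus ?thesis unfolding leading_digit_def by linarith
qed

lemma tail_ge_1: "1 \<le> tail x"
proof -
  have "0 < of_int \<lfloor>x\<rfloor> + 1 - x" "of_int \<lfloor>x\<rfloor> + 1 - x \<le> 1" by linarith+
  thus ?thesis unfolding tail_def by simp
qed

lemma leading_digit_minus_inverse_tail:
  "1 \<le> x \<Longrightarrow> real (leading_digit x) - 1 / tail x = x"
  by (simp add: real_leading_digit tail_def)

lemma leading_digit_mono: "x \<le> y \<Longrightarrow> leading_digit x \<le> leading_digit y"
  unfolding leading_digit_def by (intro nat_mono add_right_mono floor_mono)

lemma tail_mono:
  assumes "1 \<le> x" "x \<le> y" "leading_digit x = leading_digit y"
  shows "tail x \<le> tail y"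
proof -
  have "real_of_int \<lfloor>x\<rfloor> = real_of_int \<lfloor>y\<rfloor>"
    using assms real_leading_digit[of x] real_leading_digit[of y] by simp
  thus ?thesis unfolding tail_def using assms
    by (auto intro!: divide_left_mono mult_pos_pos) linarith+
qed

lemma digit_minus_inverse_gt_1: "2 \<le> c \<Longrightarrow> 1 < t \<Longrightarrow> 1 < real c - 1 / t"
proof -
  assume "2 \<le> c" "1 < t"
  hence "1 / t < 1" "2 \<le> real c" by auto
  thus ?thesis by linarith
qed

lemma nonintegral_eq_digit_minus_inverse:
  fixes t :: real
  assumes "1 < t" "t \<notin> \<int>"
  obtains n s where "1 < s" "t = real (n + 2) - 1 / s"
proof
  define n where "n = nat (\<lfloor>t\<rfloor> - 1)"
  have "1 \<le> \<lfloor>t\<rfloor>" using assms(1) by (simp add: le_floor_iff)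
  hence n: "real (n + 2) = of_int \<lfloor>t\<rfloor> + 1" unfolding n_def by simp
  have "of_int \<lfloor>t\<rfloor> \<noteq> t" using assms(2) by (metis Ints_of_int)
  hence "of_int \<lfloor>t\<rfloor> < t" "t < of_int \<lfloor>t\<rfloor> + 1" by linarith+
  thus "1 < 1 / (real (n + 2) - t)" unfolding n by simp
  show "t = real (n + 2) - 1 / (1 / (real (n + 2) - t))" by simp
qed

lemma digits_ge_2: "1 \<le> x \<Longrightarrow> 2 \<le> digits x j"
  by (induction j arbitrary: x) (auto simp: leading_digit_ge_2 tail_ge_1)

lemma digit_tail_eqI:
  assumes "1 \<le> y" "x = real c - 1 / y"
  shows "leading_digit x = c" "tail x = y"
proof -
  have "0 < 1 / y" "1 / y \<le> 1" using assms by auto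
  hence "\<lfloor>x\<rfloor> = int c - 1" using assms by linarith
  thus "leading_digit x = c" "tail x = y"
    using assms by (auto simp: leading_digit_def tail_def)
qed

lemma ncf_gt_1: "\<forall>j. 2 \<le> c j \<Longrightarrow> 1 < ncf c n"
proof (induction n arbitrary: c)
  case 0
  have "2 \<le> c 0" using 0 by blast
  thus ?case by simp
next
  case (Suc n)
  have "1 < ncf (\<lambda>j. c (Suc j)) n" using Suc.prems by (intro Suc.IH) simp
  moreover have "2 \<le> real (c 0)" using Suc.prems by (metis of_nat_le_iff of_nat_numeral)
  moreover from calculation(1) have "1 / ncf (\<lambda>j. c (Suc j)) n < 1" by simp
  ultimately show ?case unfolding ncf.simps(2) by linarith
qed

lemma ncf_Suc_le: "\<forall>j. 2 \<le> c j \<Longrightarrow> ncf c (Suc n) \<le> ncf c n"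
proof (induction n arbitrary: c)
  case 0
  thus ?case by simp
next
  case (Suc n)
  have "1 < ncf (\<lambda>j. c (Suc j)) (Suc n)" using Suc.prems by (intro ncf_gt_1) simp
  moreover have "ncf (\<lambda>j. c (Suc j)) (Suc n) \<le> ncf (\<lambda>j. c (Suc j)) n"
    using Suc.prems by (intro Suc.IH) simp
  ultimately have "1 / ncf (\<lambda>j. c (Suc j)) n \<le> 1 / ncf (\<lambda>j. c (Suc j)) (Suc n)"
    by (intro divide_left_mono) auto
  thus ?case by (subst (1 2) ncf.simps(2)) linarith
qed

lemma ncf_convergent:
  assumes "\<forall>j. 2 \<le> c j"
  obtains y where "1 \<le> y" "ncf c \<longlonglongrightarrow> y"
proof -
  have "decseq (ncf c)" using ncf_Suc_le[OF assms] by (simp add: decseq_Suc_iff)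
  moreover have "\<forall>i. 1 \<le> ncf c i" using ncf_gt_1[OF assms] less_imp_le by blast
  ultimately obtain y where "ncf c \<longlonglongrightarrow> y" using decseq_convergent by blast
  moreover have "1 \<le> y"
    using \<open>\<forall>i. 1 \<le> ncf c i\<close> calculation by (intro LIMSEQ_le_const) auto
  ultimately show ?thesis using that by blast
qed

text \<open>
  The convergents of the remaining digits decrease and stay above \<open>1\<close>, so they converge to some \<open>y \<ge> 1\<close> with
  \<open>x = c 0 - 1 / y\<close>. This determines \<open>c 0\<close> and \<open>y\<close>, and the remaining digits expand \<open>y\<close>.
\<close>

lemma ncf_digits_unique: "\<forall>j. 2 \<le> c j \<Longrightarrow> ncf c \<longlonglongrightarrow> x \<Longrightarrow> c j = digits x j"
proof (induction j arbitrary: c x)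
  have tails: "c 0 = leading_digit x \<and> ncf (\<lambda>j. c (Suc j)) \<longlonglongrightarrow> tail x"
    if c: "\<forall>j. 2 \<le> c j" and x: "ncf c \<longlonglongrightarrow> x" for c x
  proof -
    obtain y where y: "1 \<le> y" "ncf (\<lambda>j. c (Suc j)) \<longlonglongrightarrow> y"
      using ncf_convergent[of "\<lambda>j. c (Suc j)"] c by blast
    have "(\<lambda>n. ncf c (Suc n)) \<longlonglongrightarrow> real (c 0) - 1 / y"
      unfolding ncf.simps using y by (intro tendsto_intros) auto
    moreover have "(\<lambda>n. ncf c (Suc n)) \<longlonglongrightarrow> x" using x by (rule LIMSEQ_Suc)
    ultimately have "x = real (c 0) - 1 / y" by (rule LIMSEQ_unique[symmetric])
    from digit_tail_eqI[OF y(1) this] y show ?thesis by auto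
  qed
  {
    case 0
    thus ?case using tails by auto
  next
    case (Suc j)
    have "\<forall>j. 2 \<le> c (Suc j)" using Suc.prems by blast
    moreover have "ncf (\<lambda>j. c (Suc j)) \<longlonglongrightarrow> tail x" using tails Suc.prems by blast
    ultimately show ?case using Suc.IH[of "\<lambda>j. c (Suc j)" "tail x"] by simp
  }
qed

text \<open>
  The error bound rests on the map \<open>\<delta> \<mapsto> \<delta> / (1 + \<delta>)\<close>: for \<open>y \<ge> 1\<close> the error
  of \<open>- 1 / (y + \<delta>)\<close> as a value for \<open>- 1 / y\<close> is \<open>\<delta> / (y * (y + \<delta>)) \<le> \<delta> / (1 + \<delta>)\<close>, and this map takes
  \<open>1 / n\<close> to \<open>1 / (n + 1)\<close>.
\<close>

lemma ncf_digits_error: "1 \<le> x \<Longrightarrow> x \<le> ncf (digits x) n \<and> ncf (digits x) n \<le> x + 1 / (real n + 1)"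
proof (induction n arbitrary: x)
  case 0
  thus ?case by (auto simp: real_leading_digit intro: less_imp_le)
next
  case (Suc n)
  define y where "y = tail x"
  define z where "z = ncf (digits y) n"
  have y: "1 \<le> y" unfolding y_def by (rule tail_ge_1)
  have z: "y \<le> z" "z \<le> y + 1 / (real n + 1)" using Suc.IH[OF y] unfolding z_def by auto
  have ncf_eq: "ncf (digits x) (Suc n) = x + (1 / y - 1 / z)"
    using leading_digit_minus_inverse_tail[OF Suc.prems] by (simp add: y_def z_def)
  have "1 / z \<le> 1 / y" using y z by (intro divide_left_mono) auto
  moreover have "1 / y - 1 / z \<le> 1 / (real (Suc n) + 1)"
  proof -
    have "1 / y - 1 / z = (z - y) / (y * z)" using y z by (simp add: field_simps)
    also have "\<dots> \<le> (z - y) / (1 * (1 + (z - y)))"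
      using y z by (intro divide_left_mono mult_mono mult_pos_pos) auto
    also have "\<dots> = 1 - 1 / (1 + (z - y))" using z by (simp add: field_simps)
    also have "\<dots> \<le> 1 - 1 / (1 + 1 / (real n + 1))"
      using z by (intro diff_left_mono divide_left_mono mult_pos_pos add_pos_nonneg) auto
    also have "\<dots> = 1 / (real (Suc n) + 1)" by (simp add: field_simps)
    finally show ?thesis .
  qed
  ultimately show ?case unfolding ncf_eq by linarith
qed

lemma ncf_digits_tendsto: assumes "1 \<le> x" shows "ncf (digits x) \<longlonglongrightarrow> x"
proof (rule tendsto_sandwich[of "\<lambda>_. x" _ _ "\<lambda>n. x + 1 / (real n + 1)"])
  show "(\<lambda>n. x + 1 / (real n + 1)) \<longlonglongrightarrow> x"
    using tendsto_add[OF tendsto_const[of x] LIMSEQ_inverse_real_of_nat]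
    by (simp add: inverse_eq_divide add.commute)
qed (use ncf_digits_error[OF assms] in auto)

lemma ncf_expansion_eq_digits: "1 \<le> x \<Longrightarrow> ncf_expansion x = digits x"
  unfolding ncf_expansion_def
  by (rule the_equality) (auto simp: digits_ge_2 ncf_digits_tendsto ncf_digits_unique)

section \<open>Functional equations and monotonicity of the deformation\<close>

context
  fixes q :: real
  assumes q: "0 < q" "q < 1"
begin

lemma qint_Suc: "qint q (Suc n) = 1 + q * qint q n"
  using q by (simp add: qint_def field_simps)

lemma qint_Suc_add_power: "qint q (Suc n) = qint q n + q ^ n"
  using q by (simp add: qint_def field_simps)

lemma qint_1: "qint q 1 = 1"
  using q by (simp add: qint_def)

lemma qint_le: "qint q n \<le> 1 / (1 - q)"
  using q by (simp add: qint_def divide_right_mono)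

lemma qint_mono: "m \<le> n \<Longrightarrow> qint q m \<le> qint q n"
  using q by (simp add: qint_def divide_right_mono power_decreasing)

lemma qint_ge_1: "1 \<le> n \<Longrightarrow> 1 \<le> qint q n"
  using qint_mono[of 1 n] qint_1 by simp

lemma qint_minus_power: "1 \<le> n \<Longrightarrow> qint q n - q ^ (n - 1) = qint q (n - 1)"
  using qint_Suc_add_power[of "n - 1"] by simp

lemma qncf_digits_Suc:
  "qncf q (digits x) (Suc n) =
     qint q (leading_digit x) - q ^ (leading_digit x - 1) / qncf q (digits (tail x)) n"
  by simp

text \<open>
  The last conjunct is the invariant that lets the induction bound the fraction by its numerator
  \<open>q ^ (c - 1)\<close>.
\<close>

lemma qncf_digits_bounds: "1 \<le> x \<Longrightarrow> qint q (leading_digit x - 1) \<le> qncf q (digits x) n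
    \<and> qncf q (digits x) n \<le> qint q (leading_digit x) \<and> 1 \<le> qncf q (digits x) n"
proof (induction n arbitrary: x)
  case 0
  have "1 \<le> leading_digit x" using leading_digit_ge_2[OF 0] by simp
  thus ?case using qint_mono qint_ge_1 by simp
next
  case (Suc n)
  define c where "c = leading_digit x"
  define v where "v = qncf q (digits (tail x)) n"
  have c: "2 \<le> c" unfolding c_def using leading_digit_ge_2[OF Suc.prems] .
  have v: "1 \<le> v" unfolding v_def using Suc.IH[OF tail_ge_1] by blast
  have "0 < q ^ (c - 1)" using q by simp
  hence "q ^ (c - 1) / v \<le> q ^ (c - 1) / 1" "0 \<le> q ^ (c - 1) / v"
    using v by (intro divide_left_mono divide_nonneg_pos; linarith)+
  moreover have "qint q c - q ^ (c - 1) = qint q (c - 1)" using c by (intro qint_minus_power) simp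
  moreover have "1 \<le> qint q (c - 1)" using c by (intro qint_ge_1) simp
  ultimately show ?case unfolding qncf_digits_Suc c_def[symmetric] v_def[symmetric] by linarith
qed

lemma qncf_digits_ge_1: "1 \<le> x \<Longrightarrow> 1 \<le> qncf q (digits x) n"
  using qncf_digits_bounds by blast

lemma qncf_digits_Suc_le: "1 \<le> x \<Longrightarrow> qncf q (digits x) (Suc n) \<le> qncf q (digits x) n"
proof (induction n arbitrary: x)
  case 0
  thus ?case using qncf_digits_bounds[OF 0, of "Suc 0"] by simp
next
  case (Suc n)
  show ?case
    unfolding qncf_digits_Suc[of x "Suc n"] qncf_digits_Suc[of x n]
    using Suc.IH[OF tail_ge_1, of x] qncf_digits_ge_1[OF tail_ge_1, of x] q
    by (intro diff_left_mono divide_left_mono mult_pos_pos)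
       (auto intro: less_le_trans[OF zero_less_one] simp del: qncf.simps(2))
qed

text \<open>
  Truncated expansions with the same number of digits are compared: if the leading digits agree, the remainders
  decide, and otherwise \<open>[c]\<^sub>q \<le> [c' - 1]\<^sub>q\<close> separates all values with leading digit \<open>c\<close>
  from those with a larger leading digit \<open>c'\<close>.
\<close>

lemma qncf_digits_mono:
  "1 \<le> x \<Longrightarrow> x \<le> y \<Longrightarrow> qncf q (digits x) n \<le> qncf q (digits y) n"
proof (induction n arbitrary: x y)
  case 0
  thus ?case by (simp add: qint_mono leading_digit_mono)
next
  case (Suc n)
  show ?case
  proof (cases "leading_digit x = leading_digit y")
    case True
    have "qncf q (digits (tail x)) n \<le> qncf q (digits (tail y)) n"
      by (intro Suc.IH tail_ge_1 tail_mono Suc.prems True)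
    thus ?thesis unfolding qncf_digits_Suc True
      using qncf_digits_ge_1[OF tail_ge_1, of x n] q
      by (intro diff_left_mono divide_left_mono mult_pos_pos)
         (auto intro: less_le_trans[OF zero_less_one])
  next
    case False
    hence less: "leading_digit x \<le> leading_digit y - 1"
      using leading_digit_mono[OF Suc.prems(2)] by simp
    have "qncf q (digits x) (Suc n) \<le> qint q (leading_digit x)"
      using qncf_digits_bounds[OF Suc.prems(1)] by blast
    also have "\<dots> \<le> qint q (leading_digit y - 1)" using less by (rule qint_mono)
    also have "\<dots> \<le> qncf q (digits y) (Suc n)"
      using qncf_digits_bounds[OF order_trans[OF Suc.prems]] by blast
    finally show ?thesis .
  qed
qed

lemma qncf_digits_tendsto: assumes "1 \<le> x" shows "qncf q (digits x) \<longlonglongrightarrow> qreal q x"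
proof -
  have "decseq (qncf q (digits x))" using qncf_digits_Suc_le[OF assms] by (simp add: decseq_Suc_iff)
  moreover have "\<forall>i. 1 \<le> qncf q (digits x) i" using qncf_digits_ge_1[OF assms] by blast
  ultimately have "convergent (qncf q (digits x))"
    by (metis decseq_convergent convergentI)
  thus ?thesis using assms
    by (subst qreal.simps) (simp add: ncf_expansion_eq_digits convergent_LIMSEQ_iff)
qed

lemma qreal_ge_1: "1 \<le> x \<Longrightarrow> 1 \<le> qreal q x"
  using qncf_digits_ge_1 by (intro LIMSEQ_le_const[OF qncf_digits_tendsto]) auto

lemma qreal_minus_inverse:
  assumes "1 \<le> y" "2 \<le> c"
  shows "qreal q (real c - 1 / y) = qint q c - q ^ (c - 1) / qreal q y"
proof -
  define x where "x = real c - 1 / y"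
  have "1 / y \<le> 1" using assms by simp
  hence "1 \<le> x" using assms unfolding x_def by linarith
  note x = digit_tail_eqI[OF assms(1) x_def]
  have "(\<lambda>n. qncf q (digits x) (Suc n)) \<longlonglongrightarrow> qint q c - q ^ (c - 1) / qreal q y"
    unfolding qncf_digits_Suc x
    using qncf_digits_tendsto[OF assms(1)] qreal_ge_1[OF assms(1)] by (intro tendsto_intros) auto
  moreover have "(\<lambda>n. qncf q (digits x) (Suc n)) \<longlonglongrightarrow> qreal q x"
    using qncf_digits_tendsto[OF \<open>1 \<le> x\<close>] by (rule LIMSEQ_Suc)
  ultimately show ?thesis unfolding x_def by (rule LIMSEQ_unique[symmetric])
qed

lemma qreal_add_1: "qreal q (x + 1) = q * qreal q x + 1"
proof (cases "1 \<le> x")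
  case True
  define c where "c = leading_digit x"
  define y where "y = tail x"
  have c: "2 \<le> c" and y: "1 \<le> y" and x: "x = real c - 1 / y"
    unfolding c_def y_def
    using True by (auto simp: leading_digit_ge_2 tail_ge_1 leading_digit_minus_inverse_tail)
  have succ: "x + 1 = real (Suc c) - 1 / y" using x by simp
  have "qreal q (x + 1) = qint q (Suc c) - q ^ c / qreal q y"
    unfolding succ using qreal_minus_inverse[OF y, of "Suc c"] c by (simp del: of_nat_Suc)
  also have "\<dots> = q * (qint q c - q ^ (c - 1) / qreal q y) + 1"
    using c by (simp add: qint_Suc algebra_simps power_eq_if)
  also have "\<dots> = q * qreal q x + 1" using qreal_minus_inverse[OF y c] x by simp
  finally show ?thesis .
next
  case False
  thus ?thesis using q by (subst (2) qreal.simps) simp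
qed

lemma mono_qreal: "mono (qreal q)"
proof
  have ge_1: "qreal q x \<le> qreal q y" if "1 \<le> x" "x \<le> y" for x y
    using that qncf_digits_mono[OF that]
    by (intro LIMSEQ_le[OF qncf_digits_tendsto qncf_digits_tendsto]) auto
  have shifted: "qreal q x \<le> qreal q y" if "1 \<le> x + real n" "x \<le> y" for x y n
    using that
  proof (induction n arbitrary: x y)
    case 0
    thus ?case using ge_1 by simp
  next
    case (Suc n)
    have "qreal q (x + 1) \<le> qreal q (y + 1)" using Suc.prems by (intro Suc.IH) auto
    thus ?case using q by (simp add: qreal_add_1)
  qed
  fix x y :: real assume "x \<le> y"
  moreover obtain n where "1 - x \<le> real n" using real_arch_simple by blast
  ultimately show "qreal q x \<le> qreal q y" by (intro shifted[of x n]) auto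
qed

lemma qreal_le: "qreal q x \<le> 1 / (1 - q)"
proof -
  have "qreal q x \<le> qreal q (max 1 x)" by (intro monoD[OF mono_qreal]) simp
  also have "\<dots> \<le> qncf q (digits (max 1 x)) 0"
  proof (rule decseq_ge)
    show "decseq (qncf q (digits (max 1 x)))" using qncf_digits_Suc_le by (simp add: decseq_Suc_iff)
    show "qncf q (digits (max 1 x)) \<longlonglongrightarrow> qreal q (max 1 x)"
      by (intro qncf_digits_tendsto) simp
  qed
  also have "\<dots> \<le> 1 / (1 - q)" by (simp add: qint_le)
  finally show ?thesis .
qed

section \<open>Contraction over cylinders\<close>

text \<open>
  A cylinder is the set of all \<open>\<phi> t = c\<^sub>1 - 1 / (c\<^sub>2 - \<dots> - 1 / (c\<^sub>m - 1 / t))\<close> with \<open>t > 1\<close>, for a fixed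
  integer \<open>c\<^sub>1\<close> and fixed \<open>c\<^sub>2, \<dots>, c\<^sub>m \<ge> 2\<close>.
  On it \<open>[\<phi> t]\<^sub>q\<close> is a fractional linear function of \<open>[t]\<^sub>q\<close>; its pole \<open>\<sigma>\<close> measures the distortion.
  The bound \<open>\<sigma> \<le> q\<close> is inherited by all subcylinders and keeps the pole away from the range
  \<open>[1, 1 / (1 - q)]\<close> of \<open>[t]\<^sub>q\<close>, uniformly over all cylinders.
\<close>

definition q_cylinder :: "(real \<Rightarrow> real) \<Rightarrow> real \<Rightarrow> real \<Rightarrow> real \<Rightarrow> bool" where
  "q_cylinder \<phi> L k \<sigma> \<longleftrightarrow>
     continuous_on {1<..} \<phi> \<and> inj_on \<phi> {1<..} \<and> 0 < k \<and> \<sigma> \<le> q \<and>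
     (\<forall>t>1. qreal q (\<phi> t) = L - k / (qreal q t - \<sigma>))"

text \<open>
  The increment of \<open>v \<mapsto> L - k / (v - \<sigma>)\<close> from \<open>v = 1\<close> to \<open>v = 1 / (1 - q)\<close>, and so
  a bound for the variation of \<open>[x]\<^sub>q\<close> over the cylinder.
\<close>

definition q_mass :: "real \<Rightarrow> real \<Rightarrow> real" where
  "q_mass k \<sigma> = k / (1 - \<sigma>) - k / (1 / (1 - q) - \<sigma>)"

lemma q_mass_nonneg:
  assumes "0 < k" "\<sigma> \<le> q"
  shows "0 \<le> q_mass k \<sigma>"
proof -
  have "k / (1 / (1 - q) - \<sigma>) \<le> k / (1 - \<sigma>)"
    using assms q qint_le[of 1] qint_1 by (intro divide_left_mono mult_pos_pos; linarith)
  thus ?thesis unfolding q_mass_def by simp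
qed

lemma q_cylinder_increment_le:
  assumes cyl: "q_cylinder \<phi> L k \<sigma>" and "1 < s" "1 < t"
  shows "qreal q (\<phi> t) - qreal q (\<phi> s) \<le> q_mass k \<sigma>"
proof -
  have k: "0 < k" and \<sigma>: "\<sigma> \<le> q"
    and val: "qreal q (\<phi> x) = L - k / (qreal q x - \<sigma>)" if "1 < x" for x
    using cyl that unfolding q_cylinder_def by auto
  have bounds: "1 \<le> qreal q x \<and> qreal q x \<le> 1 / (1 - q)" if "1 < x" for x
    using qreal_ge_1[of x] qreal_le[of x] that by simp
  have "k / (1 / (1 - q) - \<sigma>) \<le> k / (qreal q t - \<sigma>)"
    using bounds[OF assms(3)] k[OF assms(3)] \<sigma>[OF assms(3)] q
    by (intro divide_left_mono mult_pos_pos; linarith)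
  moreover have "k / (qreal q s - \<sigma>) \<le> k / (1 - \<sigma>)"
    using bounds[OF assms(2)] k[OF assms(2)] \<sigma>[OF assms(2)] q
    by (intro divide_left_mono mult_pos_pos; linarith)
  ultimately show ?thesis unfolding q_mass_def val[OF assms(2)] val[OF assms(3)] by linarith
qed

lemma open_q_cylinder: "q_cylinder \<phi> L k \<sigma> \<Longrightarrow> open (\<phi> ` {1<..})"
  unfolding q_cylinder_def
  by (rule injective_into_1d_imp_open_map_UNIV[where S = "{1<..}" and T = "{1<..}"]) auto

text \<open>
  Substituting \<open>[c - 1 / t]\<^sub>q = [c]\<^sub>q - p / [t]\<^sub>q\<close> moves the pole from \<open>\<sigma>\<close> to \<open>p / ([c]\<^sub>q - \<sigma>)\<close>. That this is still
  at most \<open>q\<close> follows from \<open>\<sigma> \<le> q\<close> and \<open>p \<le> q\<close>; equality occurs for \<open>c = 2\<close> and \<open>\<sigma> = q\<close>.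
\<close>

lemma q_cylinder_child:
  assumes cyl: "q_cylinder \<phi> L k \<sigma>" and c: "2 \<le> c"
  defines "s \<equiv> qint q c - \<sigma>" and "p \<equiv> q ^ (c - 1)"
  shows "q_cylinder (\<lambda>t. \<phi> (real c - 1 / t)) (L - k / s) (k * p / s\<^sup>2) (p / s)"
proof -
  have k: "0 < k" and \<sigma>: "\<sigma> \<le> q" and cont: "continuous_on {1<..} \<phi>" and inj: "inj_on \<phi> {1<..}"
    and val: "\<And>x. 1 < x \<Longrightarrow> qreal q (\<phi> x) = L - k / (qreal q x - \<sigma>)"
    using cyl unfolding q_cylinder_def by auto
  have p: "0 < p" "p \<le> q" unfolding p_def
    using q c power_decreasing[of 1 "c - 1" q] by auto
  have u: "1 \<le> qint q (c - 1)" using qint_ge_1[of "c - 1"] c by simp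
  have s_eq: "s = qint q (c - 1) + p - \<sigma>"
    unfolding s_def p_def using qint_minus_power[of c] c by simp
  have s: "1 - q + p \<le> s" using s_eq u \<sigma> by linarith
  have "p / s \<le> q"
  proof -
    have "0 \<le> (1 - q) * (q - p)" using q p by simp
    hence "p \<le> q * (1 - q + p)" by (simp add: algebra_simps)
    also have "\<dots> \<le> q * s" using s q by (intro mult_left_mono) auto
    finally show ?thesis using s p q by (simp add: divide_le_eq)
  qed
  moreover have "continuous_on {1<..} (\<lambda>t. \<phi> (real c - 1 / t))"
    by (rule continuous_on_compose2[OF cont])
       (auto intro!: continuous_intros digit_minus_inverse_gt_1[OF c])
  moreover have "inj_on (\<lambda>t. \<phi> (real c - 1 / t)) {1<..}"
    using inj_onD[OF inj] digit_minus_inverse_gt_1[OF c] by (auto intro!: inj_onI) force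
  moreover have "qreal q (\<phi> (real c - 1 / t)) = L - k / s - k * p / s\<^sup>2 / (qreal q t - p / s)"
    if "1 < t" for t
  proof -
    define v where "v = qreal q t"
    have v: "1 \<le> v" unfolding v_def using qreal_ge_1 that by simp
    have "qreal q (real c - 1 / t) = qint q c - p / v"
      unfolding v_def p_def using qreal_minus_inverse[of t c] that c by simp
    hence "qreal q (\<phi> (real c - 1 / t)) = L - k / (s - p / v)"
      using val[OF digit_minus_inverse_gt_1[OF c that]] by (simp add: s_def)
    moreover have "0 < s" "0 < v" "0 < s * v - p"
    proof -
      show "0 < s" "0 < v" using s p q v by auto
      have "p < s * 1" using s q by simp
      also have "s * 1 \<le> s * v" using v \<open>0 < s\<close> by (intro mult_left_mono) auto
      finally show "0 < s * v - p" by simp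
    qed
    moreover from this have "k / (s - p / v) = k / s + k * p / s\<^sup>2 / (v - p / s)"
      by (simp add: divide_simps power2_eq_square) (simp add: algebra_simps)
    ultimately show ?thesis by (simp add: v_def)
  qed
  ultimately show ?thesis
    unfolding q_cylinder_def using k p s q by auto
qed

text \<open>
  With \<open>M v = L - k / (v - \<sigma>)\<close>, the left-hand side is \<open>M ([c - 1]\<^sub>q + q * p) - M [c - 1]\<^sub>q\<close>, the growth in the interior
  of a child, and the difference on the right is \<open>M [c]\<^sub>q - M [c - 1]\<^sub>q\<close>, which includes the jump at the right end
  of the child. Undistorted, their ratio would be \<open>q\<close>; for the distorted ratio the
  distance \<open>u \<ge> 1 - q\<close> of \<open>[c - 1]\<^sub>q\<close> from the pole is what counts.
\<close>

lemma q_mass_child_le: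
  assumes "0 < k" "\<sigma> \<le> q" "2 \<le> c"
  defines "s \<equiv> qint q c - \<sigma>" and "p \<equiv> q ^ (c - 1)"
  shows "q_mass (k * p / s\<^sup>2) (p / s)
    \<le> (1 - (1 - q)\<^sup>2) * (k / (qint q (c - 1) - \<sigma>) - k / (qint q c - \<sigma>))"
proof -
  define u where "u = qint q (c - 1) - \<sigma>"
  have p: "0 < p" "p \<le> q" unfolding p_def
    using q assms(3) power_decreasing[of 1 "c - 1" q] by auto
  have u: "1 - q \<le> u"
  proof -
    have "1 \<le> qint q (c - 1)" using assms(3) by (intro qint_ge_1) simp
    thus ?thesis unfolding u_def using assms(2) by linarith
  qed
  hence u_pos: "0 < u" using q by linarith
  have s: "s = u + p"
    unfolding s_def p_def u_def using qint_minus_power[of c] assms(3) by simp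
  have uqp: "0 < u + q * p" using u_pos p q by (intro add_pos_pos) auto
  have "q_mass (k * p / s\<^sup>2) (p / s) = k * p * q / (u * (u + q * p))"
  proof -
    have "k * p / s\<^sup>2 / (1 - p / s) = k * p / (s * u)"
      unfolding s using u_pos p by (simp add: divide_simps power2_eq_square)
    moreover have "k * p / s\<^sup>2 / (1 / (1 - q) - p / s) = k * p * (1 - q) / (s * (u + q * p))"
    proof -
      have "1 / (1 - q) - p / s = (u + q * p) / ((1 - q) * s)"
        unfolding s using u_pos p q by (simp add: field_simps)
      thus ?thesis unfolding s using u_pos p q uqp by (simp add: power2_eq_square)
    qed
    moreover have "k * p / (s * u) - k * p * (1 - q) / (s * (u + q * p)) = k * p * q / (u * (u + q * p))"
    proof -
      have fractions: "k * p / (x * y) - k * p * (1 - q) / (x * z)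
          = (k * p) * (z - (1 - q) * y) / (x * y * z)" if "0 < x" "0 < y" "0 < z" for x y z
        using that by (simp add: field_simps)
      have "k * p / (s * u) - k * p * (1 - q) / (s * (u + q * p))
          = (k * p) * ((u + q * p) - (1 - q) * u) / (s * u * (u + q * p))"
        using fractions[of s u "u + q * p"] u_pos p uqp s by simp
      also have "(u + q * p) - (1 - q) * u = q * s" unfolding s by (simp add: algebra_simps)
      finally show ?thesis unfolding s using u_pos p by simp
    qed
    ultimately show ?thesis unfolding q_mass_def by argo
  qed
  also have "\<dots> = (k * p / u) * (q / (u + q * p))" by simp
  also have "\<dots> \<le> (k * p / u) * ((1 - (1 - q)\<^sup>2) / s)"
  proof (rule mult_left_mono)
    have "p \<le> 1" using p q by linarith
    hence "(1 - q) * p \<le> 1 - q" using q by (simp add: mult_left_le)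
    also note u
    finally have "(1 - q) * p \<le> u" .
    hence "0 \<le> (1 - q) * q * (u - (1 - q) * p)" using q by simp
    also have "\<dots> = (1 - (1 - q)\<^sup>2) * (u + q * p) - q * s"
      unfolding s by (simp add: algebra_simps power2_eq_square)
    finally show "q / (u + q * p) \<le> (1 - (1 - q)\<^sup>2) / s"
      using uqp u_pos p by (simp add: s divide_simps mult.commute)
    show "0 \<le> k * p / u" using assms(1) p u_pos by simp
  qed
  also have "\<dots> = (1 - (1 - q)\<^sup>2) * (k / u - k / s)"
    unfolding s using u_pos p by (simp add: field_simps)
  finally show ?thesis unfolding u_def s_def .
qed

text \<open>
  The case \<open>n = 0\<close> is the maximal inequality. A cylinder is the union of its children and countably many
  cut points; applying the bound for \<open>n\<close> to each child and adding up gains one factor, because the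
  increments between consecutive cut points telescope to at most the mass of the cylinder.
\<close>

lemma steep_points_in_q_cylinder:
  assumes "0 < t"
  shows "q_cylinder \<phi> L k \<sigma> \<Longrightarrow> outer_le (steep_points (qreal q) t \<inter> \<phi> ` {1<..})
           (10 / t * q_mass k \<sigma> * (1 - (1 - q)\<^sup>2) ^ n)"
proof (induction n arbitrary: \<phi> L k \<sigma>)
  case 0
  hence "0 < k" "\<sigma> \<le> q" by (auto simp: q_cylinder_def)
  hence "outer_le (steep_points (qreal q) t \<inter> \<phi> ` {1<..}) (10 / t * q_mass k \<sigma>)"
    using q_cylinder_increment_le[OF 0]
    by (intro steep_points_outer_le mono_qreal open_q_cylinder[OF 0] assms q_mass_nonneg) auto
  thus ?case by simp
next
  case (Suc n)
  define E where "E = steep_points (qreal q) t"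
  define \<theta> where "\<theta> = 1 - (1 - q)\<^sup>2"
  define K where "K = 10 / t * \<theta> ^ n"
  define s where "s i = qint q (i + 2) - \<sigma>" for i
  define p where "p i = q ^ (i + 1)" for i
  define v where "v i = q_mass (k * p i / (s i)\<^sup>2) (p i / s i)" for i
  define r where "r i = k / (qint q (i + 1) - \<sigma>)" for i
  have k: "0 < k" and \<sigma>: "\<sigma> \<le> q" using Suc.prems by (auto simp: q_cylinder_def)
  have "(1 - q)\<^sup>2 \<le> 1" using q by (simp add: power_le_one)
  hence \<theta>: "0 \<le> \<theta>" unfolding \<theta>_def by simp
  hence K: "0 \<le> K" unfolding K_def using assms by simp
  have child: "q_cylinder (\<lambda>x. \<phi> (real (i + 2) - 1 / x)) (L - k / s i)
      (k * p i / (s i)\<^sup>2) (p i / s i)" for i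
    using q_cylinder_child[OF Suc.prems, of "i + 2"] by (simp add: s_def p_def)
  have "0 \<le> v i" for i
    unfolding v_def using child[of i] by (intro q_mass_nonneg) (auto simp: q_cylinder_def)
  have v_le: "v i \<le> \<theta> * (r i - r (Suc i))" for i
    using q_mass_child_le[OF k \<sigma>, of "i + 2"]
    by (simp add: v_def s_def p_def r_def \<theta>_def)
  have total: "(\<Sum>i<N. v i) \<le> \<theta> * q_mass k \<sigma>" for N
  proof -
    have "(\<Sum>i<N. v i) \<le> \<theta> * (\<Sum>i<N. r i - r (Suc i))"
      unfolding sum_distrib_left by (intro sum_mono v_le)
    also have "(\<Sum>i<N. r i - r (Suc i)) = r 0 - r N" by (rule sum_lessThan_telescope')
    also have "r 0 = k / (1 - \<sigma>)" using qint_1 by (simp add: r_def)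
    also have "k / (1 / (1 - q) - \<sigma>) \<le> r N"
      unfolding r_def using qint_ge_1[of "N + 1"] qint_le[of "N + 1"] k \<sigma> q
      by (intro divide_left_mono mult_pos_pos; linarith)
    hence "\<theta> * (k / (1 - \<sigma>) - r N) \<le> \<theta> * q_mass k \<sigma>"
      unfolding q_mass_def using \<theta> by (intro mult_left_mono) auto
    finally show ?thesis .
  qed
  have "outer_le (\<Union>i\<in>UNIV. E \<inter> (\<lambda>x. \<phi> (real (i + 2) - 1 / x)) ` {1<..}) (K * (\<theta> * q_mass k \<sigma>))"
  proof (rule outer_le_UN_countable[where v = "\<lambda>i. K * v i"])
    show "outer_le (E \<inter> (\<lambda>x. \<phi> (real (i + 2) - 1 / x)) ` {1<..}) (K * v i)" for i
      using Suc.IH[OF child[of i]] by (simp add: E_def K_def v_def \<theta>_def mult_ac)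
    show "0 \<le> K * v i" for i using K \<open>0 \<le> v i\<close> by simp
    show "(\<Sum>i\<in>F. K * v i) \<le> K * (\<theta> * q_mass k \<sigma>)" if F: "finite F" for F
    proof -
      obtain N where "F \<subseteq> {..<N}" using F finite_nat_iff_bounded by blast
      hence "sum v F \<le> sum v {..<N}" using \<open>\<And>i. 0 \<le> v i\<close> by (intro sum_mono2) auto
      also have "\<dots> \<le> \<theta> * q_mass k \<sigma>" by (rule total)
      finally show ?thesis unfolding sum_distrib_left[symmetric] using K by (rule mult_left_mono)
    qed
  qed auto
  hence "outer_le ((\<Union>i\<in>UNIV. E \<inter> (\<lambda>x. \<phi> (real (i + 2) - 1 / x)) ` {1<..}) \<union> \<phi> ` (\<int> \<inter> {1<..}))
      (K * (\<theta> * q_mass k \<sigma>))"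
    by (intro outer_le_Un_countable) (auto simp: Ints_def)
  moreover have "E \<inter> \<phi> ` {1<..} \<subseteq>
      (\<Union>i\<in>UNIV. E \<inter> (\<lambda>x. \<phi> (real (i + 2) - 1 / x)) ` {1<..}) \<union> \<phi> ` (\<int> \<inter> {1<..})"
  proof
    fix y assume y: "y \<in> E \<inter> \<phi> ` {1<..}"
    then obtain x where x: "1 < x" "y = \<phi> x" by auto
    show "y \<in> (\<Union>i\<in>UNIV. E \<inter> (\<lambda>x. \<phi> (real (i + 2) - 1 / x)) ` {1<..}) \<union> \<phi> ` (\<int> \<inter> {1<..})"
    proof (cases "x \<in> \<int>")
      case True
      thus ?thesis using x by auto
    next
      case False
      then obtain i z where "1 < z" "x = real (i + 2) - 1 / z"
        using nonintegral_eq_digit_minus_inverse x(1) by blast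
      hence "y \<in> E \<inter> (\<lambda>x. \<phi> (real (i + 2) - 1 / x)) ` {1<..}"
        using y x(2) by (intro IntI image_eqI[of _ _ z]) auto
      thus ?thesis by blast
    qed
  qed
  ultimately show ?case
    unfolding E_def[symmetric] by (rule outer_le_mono) (simp add: K_def \<theta>_def mult_ac)
qed

lemma q_cylinder_nat: "q_cylinder (\<lambda>t. real (n + 2) - 1 / t) (qint q (n + 2)) (q ^ (n + 1)) 0"
  unfolding q_cylinder_def
  using q qreal_minus_inverse[of _ "n + 2"]
  by (auto intro!: continuous_intros inj_onI)

lemma q_cylinder_shift_down:
  assumes "q_cylinder \<phi> L k \<sigma>"
  shows "q_cylinder (\<lambda>t. \<phi> t - 1) ((L - 1) / q) (k / q) \<sigma>"
proof -
  have "qreal q (\<phi> t) = q * qreal q (\<phi> t - 1) + 1" for t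
    using qreal_add_1[of "\<phi> t - 1"] by simp
  hence "qreal q (\<phi> t - 1) = (qreal q (\<phi> t) - 1) / q" for t
    using q by (simp add: field_simps)
  thus ?thesis using assms q unfolding q_cylinder_def
    by (auto intro!: continuous_intros simp: inj_on_def diff_divide_distrib)
qed

text \<open>
  These cylinders are the intervals \<open>(m - 1, m)\<close>; for \<open>m < 2\<close> they come from \<open>(1, 2)\<close> by the shift equation.
\<close>

lemma q_cylinder_int: "\<exists>L k. q_cylinder (\<lambda>t. of_int m - 1 / t) L k 0"
proof (cases "2 \<le> m")
  case True
  thus ?thesis using q_cylinder_nat[of "nat (m - 2)"] by auto
next
  case False
  have "\<exists>L k. q_cylinder (\<lambda>t. 2 - real j - 1 / t) L k 0" for j
  proof (induction j)
    case 0
    thus ?case using q_cylinder_nat[of 0] by auto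
  next
    case (Suc j)
    then obtain L k where "q_cylinder (\<lambda>t. 2 - real j - 1 / t) L k 0" by blast
    from q_cylinder_shift_down[OF this] show ?case by (auto simp: algebra_simps)
  qed
  from this[of "nat (2 - m)"] show ?thesis using False by auto
qed

lemma AE_not_steep:
  assumes "0 < t"
  shows "AE x in lborel. x \<notin> steep_points (qreal q) t"
proof -
  have "AE x in lborel. x \<notin> steep_points (qreal q) t \<inter> (\<lambda>x. of_int m - 1 / x) ` {1<..}" for m :: int
  proof -
    obtain L k where cyl: "q_cylinder (\<lambda>x. of_int m - 1 / x) L k 0" using q_cylinder_int by blast
    have "0 < (1 - q)\<^sup>2" "(1 - q)\<^sup>2 \<le> 1" using q by (auto simp: power_le_one)
    hence "(\<lambda>n. 10 / t * q_mass k 0 * (1 - (1 - q)\<^sup>2) ^ n) \<longlonglongrightarrow> 0"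
      by (intro tendsto_mult_right_zero LIMSEQ_realpow_zero) auto
    with steep_points_in_q_cylinder[OF assms cyl] show ?thesis by (rule AE_not_in_of_outer_le)
  qed
  hence "AE x in lborel. \<forall>m::int. x \<notin> steep_points (qreal q) t \<inter> (\<lambda>x. of_int m - 1 / x) ` {1<..}"
    unfolding AE_all_countable by blast
  moreover have "AE x in lborel. x \<notin> (\<int> :: real set)"
    by (intro AE_not_in countable_imp_null_set_lborel) (simp add: Ints_def)
  ultimately show ?thesis
  proof eventually_elim
    case (elim x)
    define z where "z = 1 / (of_int \<lfloor>x\<rfloor> + 1 - x)"
    have "of_int \<lfloor>x\<rfloor> \<noteq> x" using elim(2) by (metis Ints_of_int)
    hence "of_int \<lfloor>x\<rfloor> < x" "x < of_int \<lfloor>x\<rfloor> + 1" by linarith+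
    hence "1 < z" unfolding z_def by simp
    moreover have "x = of_int (\<lfloor>x\<rfloor> + 1) - 1 / z" unfolding z_def by simp
    ultimately have "x \<in> (\<lambda>s. of_int (\<lfloor>x\<rfloor> + 1) - 1 / s) ` {1<..}"
      by (intro image_eqI[of _ _ z]) auto
    thus ?case using elim(1) by blast
  qed
qed

end

section \<open>The derivative\<close>

theorem proposition5p4:
  fixes q :: real
  assumes "0 < q" and "q < 1"
  shows "AE x in lebesgue. (qreal q has_real_derivative 0) (at x)
           \<and> (qreal_star q has_real_derivative 0) (at x)"
proof -
  have mono: "mono (qreal q)" using assms by (rule mono_qreal)
  have star: "qreal_star q = (\<lambda>x. qreal q x + (\<Sum>\<^sub>\<infinity>y\<in>{y \<in> \<rat>. x < y}. left_jump (qreal q) y))"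
    by (simp add: fun_eq_iff qreal_star_def qjump_def left_jump_def)
  have star_mono: "mono (qreal_star q)"
    unfolding star by (rule mono_add_later_jumps[OF mono qreal_le[OF assms]])
  have star_le: "qreal_star q v - qreal_star q u \<le> qreal q v - qreal q u" if "u \<le> v" for u v
    unfolding star using that by (rule add_later_jumps_increment_le[OF mono qreal_le[OF assms]])
  have "AE x in lborel. \<forall>k. x \<notin> steep_points (qreal q) (1 / Suc k)"
    using AE_not_steep[OF assms] by (simp add: AE_all_countable)
  hence "AE x in lborel. (qreal q has_real_derivative 0) (at x)
           \<and> (qreal_star q has_real_derivative 0) (at x)"
    by eventually_elim
      (auto intro!: has_derivative_0_of_not_steep[OF mono mono]
         has_derivative_0_of_not_steep[OF mono star_mono star_le])
  thus ?thesis by (rule AE_completion)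
qed

end
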